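(* Let $(L,[\cdot,\cdot,\cdot],\alpha,\beta)$ be a complex $3$-Bihom-Lie algebra and let $E\colon L\to L$ be a $\mathbb{C}$-linear map. Then $E$ is a product structure on $L$ if and only if $J=iE$ is a complex structure on $L$.
   Context: A complex $3$-Bihom-Lie algebra is a $4$-tuple $(L,[\cdot,\cdot,\cdot],\alpha,\beta)$ consisting of a complex vector space $L$, a $\mathbb{C}$-trilinear map $[\cdot,\cdot,\cdot]\colon L\times L\times L\to L$ and two $\mathbb{C}$-linear maps $\alpha,\beta\colon L\to L$ such that for all $x,y,z,u,v\in L$: (1) $\alpha\beta=\beta\alpha$; (2) $\alpha([x,y,z])=[\alpha(x),\alpha(y),\alpha(z)]$ and $\beta([x,y,z])=[\beta(x),\beta(y),\beta(z)]$; (3) $[\beta(x),\beta(y),\alpha(z)]=-[\beta(y),\beta(x),\alpha(z)]=-[\beta(x),\beta(z),\alpha(y)]$; (4) $[\beta^2(u),\beta^2(v),[\beta(x),\beta(y),\alpha(z)]]=[\beta^2(y),\beta^2(z),[\beta(u),\beta(v),\alpha(x)]]-[\beta^2(x),\beta^2(z),[\beta(u),\beta(v),\alpha(y)]]+[\beta^2(x),\beta^2(y),[\beta(u),\beta(v),\alpha(z)]]$. A product structure on $L$ is a $\mathbb{C}$-linear map $E\colon L\to L$ with $E^2=\mathrm{Id}$, $E\neq\pm\mathrm{Id}$, $\alpha E=E\alpha$, $\beta E=E\beta$ and, for all $x,y,z\in L$, $$E[x,y,z]=[Ex,Ey,Ez]+[Ex,y,z]+[x,Ey,z]+[x,y,Ez]-E[Ex,Ey,z]-E[x,Ey,Ez]-E[Ex,y,Ez].$$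 A ($\mathbb{C}$-linear) complex structure on $L$ is a $\mathbb{C}$-linear map $J\colon L\to L$ with $J^2=-\mathrm{Id}$, $J\alpha=\alpha J$, $J\beta=\beta J$ and, for all $x,y,z\in L$, $$J[x,y,z]=-[Jx,Jy,Jz]+[Jx,y,z]+[x,Jy,z]+[x,y,Jz]+J[Jx,Jy,z]+J[x,Jy,Jz]+J[Jx,y,Jz].$$
   Formalization: The formal theorem additionally assumes E ≠ Id and E ≠ -Id: for E = ±Id the stated equivalence is false, since ±Id is not a product structure but ±i·Id is always a complex structure. *)

theory Defs
  imports Complex_Main
begin

text \<open>The underlying space is the whole type \<^typ>\<open>'a\<close>, with complex scalar multiplication
  \<open>scale\<close>.\<close>

locale three_bihom_lie_algebra = vector_space scale
  for scale :: "complex \<Rightarrow> 'a::ab_group_add \<Rightarrow> 'a" +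
  fixes br :: "'a \<Rightarrow> 'a \<Rightarrow> 'a \<Rightarrow> 'a"
    and \<alpha> \<beta> :: "'a \<Rightarrow> 'a"
  assumes linear_br1: "Vector_Spaces.linear scale scale (\<lambda>x. br x y z)"
    and linear_br2: "Vector_Spaces.linear scale scale (\<lambda>y. br x y z)"
    and linear_br3: "Vector_Spaces.linear scale scale (\<lambda>z. br x y z)"
    and linear_alpha: "Vector_Spaces.linear scale scale \<alpha>"
    and linear_beta: "Vector_Spaces.linear scale scale \<beta>"
    and alpha_beta_commute: "\<alpha> (\<beta> x) = \<beta> (\<alpha> x)"
    and alpha_br: "\<alpha> (br x y z) = br (\<alpha> x) (\<alpha> y) (\<alpha> z)"
    and beta_br: "\<beta> (br x y z) = br (\<beta> x) (\<beta> y) (\<beta> z)"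
    and skew12: "br (\<beta> x) (\<beta> y) (\<alpha> z) = - br (\<beta> y) (\<beta> x) (\<alpha> z)"
    and skew23: "br (\<beta> x) (\<beta> y) (\<alpha> z) = - br (\<beta> x) (\<beta> z) (\<alpha> y)"
    and bihom_jacobi:
      "br (\<beta> (\<beta> u)) (\<beta> (\<beta> v)) (br (\<beta> x) (\<beta> y) (\<alpha> z)) =
         br (\<beta> (\<beta> y)) (\<beta> (\<beta> z)) (br (\<beta> u) (\<beta> v) (\<alpha> x))
       - br (\<beta> (\<beta> x)) (\<beta> (\<beta> z)) (br (\<beta> u) (\<beta> v) (\<alpha> y))
       + br (\<beta> (\<beta> x)) (\<beta> (\<beta> y)) (br (\<beta> u) (\<beta> v) (\<alpha> z))"

definition product_structure ::
  "(complex \<Rightarrow> 'a::ab_group_add \<Rightarrow> 'a) \<Rightarrow> ('a \<Rightarrow> 'a \<Rightarrow> 'a \<Rightarrow> 'a) \<Rightarrow> ('a \<Rightarrow> 'a) \<Rightarrow> ('a \<Rightarrow> 'a) \<Rightarrow> ('a \<Rightarrow> 'a) \<Rightarrow> bool"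
  where "product_structure scale br \<alpha> \<beta> E \<longleftrightarrow>
    Vector_Spaces.linear scale scale E \<and>
    E \<circ> E = id \<and> E \<noteq> id \<and> E \<noteq> uminus \<and>
    \<alpha> \<circ> E = E \<circ> \<alpha> \<and> \<beta> \<circ> E = E \<circ> \<beta> \<and>
    (\<forall>x y z. E (br x y z) =
        br (E x) (E y) (E z) + br (E x) y z + br x (E y) z + br x y (E z)
      - E (br (E x) (E y) z) - E (br x (E y) (E z)) - E (br (E x) y (E z)))"

definition complex_structure ::
  "(complex \<Rightarrow> 'a::ab_group_add \<Rightarrow> 'a) \<Rightarrow> ('a \<Rightarrow> 'a \<Rightarrow> 'a \<Rightarrow> 'a) \<Rightarrow> ('a \<Rightarrow> 'a) \<Rightarrow> ('a \<Rightarrow> 'a) \<Rightarrow> ('a \<Rightarrow> 'a) \<Rightarrow> bool"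
  where "complex_structure scale br \<alpha> \<beta> J \<longleftrightarrow>
    Vector_Spaces.linear scale scale J \<and>
    J \<circ> J = uminus \<and>
    J \<circ> \<alpha> = \<alpha> \<circ> J \<and> J \<circ> \<beta> = \<beta> \<circ> J \<and>
    (\<forall>x y z. J (br x y z) =
      - br (J x) (J y) (J z) + br (J x) y z + br x (J y) z + br x y (J z)
      + J (br (J x) (J y) z) + J (br x (J y) (J z)) + J (br (J x) y (J z)))"

text \<open>The hypothesis \<open>E \<noteq> \<plusminus>Id\<close> of the main statement cannot be dropped:
  \<open>\<plusminus>Id\<close> is not a product structure, but \<open>\<plusminus>\<i> Id\<close> is a complex structure on
  every complex 3-Bihom-Lie algebra.\<close>

lemma complex_structure_i_id:
  assumes "three_bihom_lie_algebra scale br \<alpha> \<beta>"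
  shows "complex_structure scale br \<alpha> \<beta> (\<lambda>x. scale \<i> x)"
    and "complex_structure scale br \<alpha> \<beta> (\<lambda>x. scale \<i> (- x))"
proof -
  interpret three_bihom_lie_algebra scale br \<alpha> \<beta> by (fact assms)
  have sc: "br (scale c x) y z = scale c (br x y z)" "br x (scale c y) z = scale c (br x y z)"
    "br x y (scale c z) = scale c (br x y z)" for c x y z
    using linear_br1 linear_br2 linear_br3
    by (simp_all add: Vector_Spaces.linear_iff)
  have ng: "br (- x) y z = - br x y z" "br x (- y) z = - br x y z" "br x y (- z) = - br x y z"
    for x y z
    using sc[where c = "- 1"] by simp_all
  have ab: "\<alpha> (scale c x) = scale c (\<alpha> x)" "\<beta> (scale c x) = scale c (\<beta> x)" for c x
    using linear_alpha linear_beta by (simp_all add: Vector_Spaces.linear_iff)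
  have ab_minus: "\<alpha> (- x) = - \<alpha> x" "\<beta> (- x) = - \<beta> x" for x
    using ab[where c = "- 1"] by simp_all
  have lin: "Vector_Spaces.linear scale scale (\<lambda>x. scale \<i> x)"
    "Vector_Spaces.linear scale scale (\<lambda>x. scale \<i> (- x))"
    by (simp_all add: Vector_Spaces.linear_iff vector_space_axioms scale_right_distrib mult.commute)
  show "complex_structure scale br \<alpha> \<beta> (\<lambda>x. scale \<i> x)"
    "complex_structure scale br \<alpha> \<beta> (\<lambda>x. scale \<i> (- x))"
    unfolding complex_structure_def using lin
    by (simp_all add: fun_eq_iff sc ng ab ab_minus)
qed

end

theory Submission
  imports Defs
begin

text \<open>Every term of the two integrability identities has degree 1 or 3 in the structure map. Those of
  degree 1 have the same sign in both identities and those of degree 3 have opposite signs; since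
  \<open>\<i>\<^sup>3 = -\<i>\<close>, the identity for \<open>J = \<i>E\<close> is \<open>\<i>\<close> times the identity for \<open>E\<close>.\<close>

theorem proposition4p23:
  fixes scale :: "complex \<Rightarrow> 'a::ab_group_add \<Rightarrow> 'a"
    and br :: "'a \<Rightarrow> 'a \<Rightarrow> 'a \<Rightarrow> 'a"
    and \<alpha> \<beta> E :: "'a \<Rightarrow> 'a"
  assumes "three_bihom_lie_algebra scale br \<alpha> \<beta>"
    and "Vector_Spaces.linear scale scale E"
    and "E \<noteq> id" and "E \<noteq> uminus"
  shows "product_structure scale br \<alpha> \<beta> E \<longleftrightarrow>
    complex_structure scale br \<alpha> \<beta> (\<lambda>x. scale \<i> (E x))"
proof -
  interpret three_bihom_lie_algebra scale br \<alpha> \<beta> by (fact assms(1))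
  let ?J = "\<lambda>x. scale \<i> (E x)"
  have br_scale: "br (scale c x) y z = scale c (br x y z)"
    "br x (scale c y) z = scale c (br x y z)" "br x y (scale c z) = scale c (br x y z)" for c x y z
    using linear_br1 linear_br2 linear_br3 by (simp_all add: Vector_Spaces.linear_iff)
  have \<alpha>\<beta>_scale: "\<alpha> (scale c x) = scale c (\<alpha> x)" "\<beta> (scale c x) = scale c (\<beta> x)" for c x
    using linear_alpha linear_beta by (simp_all add: Vector_Spaces.linear_iff)
  have E_scale: "E (scale c x) = scale c (E x)" for c x
    using assms(2) by (simp add: Vector_Spaces.linear_iff)
  \<comment> \<open>In \<open>rhs\<close>, two factors \<open>\<i>\<close> pulled out of a bracket
    merge into a minus sign, which must then pass through the outer \<open>E\<close>.\<close>
  have E_minus: "E (- x) = - E x" for x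
    using E_scale[where c = "- 1"] by simp
  have scale_i_iff: "scale \<i> x = scale \<i> y \<longleftrightarrow> x = y" for x y
    by simp
  have linear_J: "Vector_Spaces.linear scale scale ?J"
    using assms(2) by (simp add: Vector_Spaces.linear_iff scale_right_distrib mult.commute)
  have square: "?J \<circ> ?J = uminus \<longleftrightarrow> E \<circ> E = id"
    by (simp add: fun_eq_iff E_scale)
  have commute: "?J \<circ> \<alpha> = \<alpha> \<circ> ?J \<longleftrightarrow> \<alpha> \<circ> E = E \<circ> \<alpha>" "?J \<circ> \<beta> = \<beta> \<circ> ?J \<longleftrightarrow> \<beta> \<circ> E = E \<circ> \<beta>"
    by (auto simp add: fun_eq_iff \<alpha>\<beta>_scale)
  \<comment> \<open>The left side copies the right side of the identity for \<open>?J\<close>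
    literally, so that it can act as a rewrite rule in the final unfolding.\<close>
  have rhs: "- br (?J x) (?J y) (?J z) + br (?J x) y z + br x (?J y) z + br x y (?J z)
      + ?J (br (?J x) (?J y) z) + ?J (br x (?J y) (?J z)) + ?J (br (?J x) y (?J z)) =
      scale \<i> (br (E x) (E y) (E z) + br (E x) y z + br x (E y) z + br x y (E z)
      - E (br (E x) (E y) z) - E (br x (E y) (E z)) - E (br (E x) y (E z)))" for x y z
    by (simp add: br_scale E_scale E_minus scale_right_distrib scale_right_diff_distrib)
  \<comment> \<open>After \<open>rhs\<close>, both sides of the identity for \<open>?J\<close> carry
    a factor \<open>\<i>\<close>, which \<open>scale_i_iff\<close> cancels. The conditions
    \<open>E \<noteq> id\<close> and \<open>E \<noteq> uminus\<close> have no counterpart for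
    \<open>?J\<close> and come from the assumptions.\<close>
  show ?thesis
    unfolding product_structure_def complex_structure_def rhs scale_i_iff square commute
    using assms linear_J by simp
qed

end
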